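(* Let $q\ge 1$ and $(\varepsilon_n)$ be fixed, and suppose that the following two hypotheses hold. (Permutation) $\widehat A_{\mathfrak h,\eta}\equiv\widehat A_{\eta,\mathfrak h}$ for all $\mathfrak h,\eta\in\mathfrak H$. (Upper function) For every $n\ge 1$, $$\sup_{f\in\mathbb F}\mathbb E^{(n)}_{1,f}\Big(\sup_{\mathfrak h\in\mathfrak H_n}\big[\ell(\widehat A_{\mathfrak h},\Lambda_{\mathfrak h}(f))-\Psi_n(\mathfrak h)\big]_+^q\Big)\le\varepsilon_n^q,$$ $$\sup_{f\in\mathbb F}\mathbb E^{(n)}_{1,f}\Big(\sup_{\mathfrak h,\eta\in\mathfrak H_n}\big[\ell(\widehat A_{\mathfrak h,\eta},\Lambda_{\mathfrak h,\eta}(f))-\min\{\Psi_n(\mathfrak h),\Psi_n(\eta)\}\big]_+^q\Big)\le\varepsilon_n^q.$$ Let $\hat{\mathfrak h}^{(n)}$ be selected by the $(\Psi_n,\ell)$-selection rule. Then for every $f\in\mathbb F$ and every $n\ge1$ $$\mathcal R_A\big[\widehat A_{\hat{\mathfrak h}^{(n)}},f\big]\le\inf_{\mathfrak h\in\mathfrak H_n}\Big\{\mathcal B^{(n)}_A(f,\mathfrak h)+5\,\psi_n(f,\mathfrak h)\Big\}+6\,\varepsilon_n .$$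
   Context: Setting. For each $n\ge1$ let $(\mathcal X^{(n)},\mathfrak T^{(n)},\mathbb P^{(n)}_f, f\in\mathbb F)$ be a statistical experiment generated by an observation $X^{(n)}=(X^{(n)}_1,X^{(n)}_2)$, where $X_1^{(n)},X_2^{(n)}$ are independent random elements with marginal laws $\mathbb P^{(n)}_{1,f},\mathbb P^{(n)}_{2,f}$; $\mathbb E^{(n)}_f,\mathbb E^{(n)}_{1,f},\mathbb E^{(n)}_{2,f}$ are the corresponding expectations. Let $A:\mathbb F\to\mathfrak S_1$ be a map to be estimated, where $\mathfrak S_1$ is endowed with a semi-metric $\ell$. For an $X^{(n)}$-measurable $\mathfrak S_1$-valued map $\widetilde Q$ the risk is $\mathcal R_A[\widetilde Q,f]=\big(\mathbb E^{(n)}_f[\ell(\widetilde Q,A(f))]^q\big)^{1/q}$. Let $\mathfrak H$ be a parameter set, $\mathfrak H_n\subseteq\mathfrak H$ countable subsets, $\{\widehat A_{\mathfrak h}\}_{\mathfrak h\in\mathfrak H}$ and $\{\widehat A_{\mathfrak h,\eta}\}_{\mathfrak h,\eta\in\mathfrak H}$ families of $X_1^{(n)}$-measurable $\mathfrak S_1$-valued maps (possibly depending on $n$), $\{\Lambda_{\mathfrak h}(f)\}$ and $\{\Lambda_{\mathfrak h,\eta}(f)\}$ ($\mathfrak h,\eta\in\mathfrak H$, $f\in\mathbb F$) collections of $\mathfrak S_1$-valued functionals (possibly depending on $n$), and $\{\Psi_n(\mathfrak h)\}_{\mathfrak h\in\mathfrak H}$ positive $X_1^{(n)}$-measurable random variables.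 Let $\varepsilon_n\ge0$, $\varepsilon_n\to0$, be a given sequence. Random quantities whose expectations appear are understood to be measurable. $[x]_+=\max(x,0)$. $(\Psi_n,\ell)$-selection rule. Put $$\widehat R_n(\mathfrak h)=\sup_{\eta\in\mathfrak H_n}\big[\ell(\widehat A_{\mathfrak h,\eta},\widehat A_\eta)-2\Psi_n(\eta)\big]_+,\quad \mathfrak h\in\mathfrak H_n,$$ and let $\hat{\mathfrak h}^{(n)}\in\mathfrak H_n$ be an arbitrary $X_1^{(n)}$-measurable random element satisfying $$\widehat R_n(\hat{\mathfrak h}^{(n)})+2\Psi_n(\hat{\mathfrak h}^{(n)})\le\inf_{\mathfrak h\in\mathfrak H_n}\{\widehat R_n(\mathfrak h)+2\Psi_n(\mathfrak h)\}+\varepsilon_n',$$ where $\varepsilon_n'$ is an arbitrary sequence with $\varepsilon'_n\le\varepsilon_n$. Notation: for $f\in\mathbb F$, $\mathfrak h\in\mathfrak H_n$, $$\mathcal B^{(n)}_A(f,\mathfrak h)=\ell(\Lambda_{\mathfrak h}(f),A(f))+2\sup_{\eta\in\mathfrak H_n}\ell(\Lambda_{\mathfrak h,\eta}(f),\Lambda_\eta(f)),\qquad \psi_n(f,\mathfrak h)=\big[\mathbb E^{(n)}_{1,f}\{\Psi_n^q(\mathfrak h)\}\big]^{1/q}.$$ *)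

theory Defs
  imports "HOL-Probability.Probability"
begin

definition semimetric :: "('s \<Rightarrow> 's \<Rightarrow> real) \<Rightarrow> bool" where
  "semimetric l \<longleftrightarrow>
     (\<forall>x y. 0 \<le> l x y) \<and> (\<forall>x. l x x = 0) \<and> (\<forall>x y. l x y = l y x) \<and>
     (\<forall>x y z. l x z \<le> l x y + l y z)"

text \<open>
  The library's \<open>indep_var\<close> forces both random elements to take values in the same type.
\<close>

definition indep_elements ::
  "'w measure \<Rightarrow> 'a measure \<Rightarrow> ('w \<Rightarrow> 'a) \<Rightarrow> 'b measure \<Rightarrow> ('w \<Rightarrow> 'b) \<Rightarrow> bool" where
  "indep_elements P M X N Y \<longleftrightarrow>
     X \<in> P \<rightarrow>\<^sub>M M \<and> Y \<in> P \<rightarrow>\<^sub>M N \<and>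
     prob_space.indep_set P {X -` B \<inter> space P | B. B \<in> sets M} {Y -` B \<inter> space P | B. B \<in> sets N}"

text \<open>
  Suprema over a countable set and expectations of nonnegative variables may be infinite, so they
  are taken in \<^typ>\<open>ennreal\<close>. The power below is meant for exponents \<open>r > 0\<close>.
\<close>

definition epow :: "ennreal \<Rightarrow> real \<Rightarrow> ennreal" where
  "epow x r = (if x = \<top> then \<top> else ennreal (enn2real x powr r))"

text \<open>
  \<open>risk P l q Q a\<close> is the risk of the estimator \<open>Q\<close> (a map on the sample space) of the value \<open>a\<close>
  under the law \<open>P\<close>.
\<close>

definition risk :: "'w measure \<Rightarrow> ('s \<Rightarrow> 's \<Rightarrow> real) \<Rightarrow> real \<Rightarrow> ('w \<Rightarrow> 's) \<Rightarrow> 's \<Rightarrow> ennreal" where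
  "risk P l q Q a = epow (\<integral>\<^sup>+ \<omega>. ennreal (l (Q \<omega>) a powr q) \<partial>P) (1 / q)"

definition psi :: "'x measure \<Rightarrow> real \<Rightarrow> ('h \<Rightarrow> 'x \<Rightarrow> real) \<Rightarrow> 'h \<Rightarrow> ennreal" where
  "psi P1 q Psi h = epow (\<integral>\<^sup>+ x. ennreal (Psi h x powr q) \<partial>P1) (1 / q)"

definition bias ::
  "('s \<Rightarrow> 's \<Rightarrow> real) \<Rightarrow> 'h set \<Rightarrow> ('h \<Rightarrow> 'f \<Rightarrow> 's) \<Rightarrow> ('h \<Rightarrow> 'h \<Rightarrow> 'f \<Rightarrow> 's) \<Rightarrow> ('f \<Rightarrow> 's) \<Rightarrow>
   'f \<Rightarrow> 'h \<Rightarrow> ennreal" where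
  "bias l H Lam Lam2 A f h =
     ennreal (l (Lam h f) (A f)) + 2 * (SUP \<eta>\<in>H. ennreal (l (Lam2 h \<eta> f) (Lam \<eta> f)))"

definition Rhat ::
  "('s \<Rightarrow> 's \<Rightarrow> real) \<Rightarrow> 'h set \<Rightarrow> ('h \<Rightarrow> 'x \<Rightarrow> 's) \<Rightarrow> ('h \<Rightarrow> 'h \<Rightarrow> 'x \<Rightarrow> 's) \<Rightarrow> ('h \<Rightarrow> 'x \<Rightarrow> real) \<Rightarrow>
   'x \<Rightarrow> 'h \<Rightarrow> ennreal" where
  "Rhat l H Ahat Ahat2 Psi x h =
     (SUP \<eta>\<in>H. ennreal (max 0 (l (Ahat2 h \<eta> x) (Ahat \<eta> x) - 2 * Psi \<eta> x)))"

text \<open>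
  The inequality of the selection rule is stated in \<^typ>\<open>ereal\<close> because the tolerance \<open>e\<close> is only
  bounded from above and may be negative.
\<close>

definition selected ::
  "('s \<Rightarrow> 's \<Rightarrow> real) \<Rightarrow> 'h set \<Rightarrow> ('h \<Rightarrow> 'x \<Rightarrow> 's) \<Rightarrow> ('h \<Rightarrow> 'h \<Rightarrow> 'x \<Rightarrow> 's) \<Rightarrow> ('h \<Rightarrow> 'x \<Rightarrow> real) \<Rightarrow>
   real \<Rightarrow> 'x \<Rightarrow> 'h \<Rightarrow> bool" where
  "selected l H Ahat Ahat2 Psi e x k \<longleftrightarrow>
     k \<in> H \<and>
     enn2ereal (Rhat l H Ahat Ahat2 Psi x k + ennreal (2 * Psi k x))
       \<le> enn2ereal (INF h\<in>H. Rhat l H Ahat Ahat2 Psi x h + ennreal (2 * Psi h x)) + ereal e"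

end

theory Submission
  imports Defs
begin

text \<open>
  Fix \<open>h\<close> and pass from the selected estimator to \<open>A f\<close> through \<open>Ahat2 h k = Ahat2 k h\<close> and
  \<open>Ahat h\<close>, where \<open>k\<close> is the selected index. The first two distances are at most
  \<open>Rhat h + 2 * Psi k\<close> and \<open>Rhat k + 2 * Psi h\<close>, and by the selection rule their sum is at most
  \<open>2 * Rhat h + 4 * Psi h + \<epsilon>\<close>. With \<open>Z1\<close> and \<open>Z2\<close> the two suprema controlled by the upper
  function hypothesis, the loss is therefore at most \<open>bias h + \<epsilon> + 5 * Psi h + 3 * Z1 + 2 * Z2\<close>
  pointwise, and Minkowski's inequality in \<open>L\<^sup>q\<close> gives the bound for the risk.
\<close>

section \<open>Powers of extended nonnegative reals\<close>

lemma epow_ennreal: "0 \<le> c \<Longrightarrow> epow (ennreal c) r = ennreal (c powr r)"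
  by (simp add: epow_def)

lemma epow_top [simp]: "epow \<top> r = \<top>"
  by (simp add: epow_def)

lemma epow_mono: "0 \<le> r \<Longrightarrow> x \<le> y \<Longrightarrow> epow x r \<le> epow y r"
  by (cases x; cases y) (auto simp: epow_ennreal powr_mono2 top_unique)

text \<open>Since \<top> is fixed by every power, exponents multiply without sign conditions. With
  the exponents \<open>q\<close> and \<open>1 / q\<close> this cancels roots against powers.\<close>

lemma epow_epow: "epow (epow x r) s = epow x (r * s)"
  by (cases x) (auto simp: epow_ennreal powr_powr)

lemma epow_one [simp]: "epow x 1 = x"
  by (cases x) (auto simp: epow_ennreal)

lemma epow_mult_ennreal:
  assumes "0 < c"
  shows "epow (ennreal c * x) r = ennreal (c powr r) * epow x r"
proof (cases x)
  case (real y)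
  with assms show ?thesis
    by (simp add: epow_ennreal powr_mult flip: ennreal_mult)
next
  case top
  with assms show ?thesis
    by (simp add: ennreal_mult_top)
qed

lemma borel_measurable_epow [measurable]:
  assumes [measurable]: "g \<in> borel_measurable M"
  shows "(\<lambda>x. epow (g x) r) \<in> borel_measurable M"
  unfolding epow_def by measurable

section \<open>Convexity of the q-th power and Minkowski's inequality in
  \<open>L\<^sup>q\<close>\<close>

lemma powr_convex_combination:
  fixes x y t q :: real
  assumes "0 \<le> x" "0 \<le> y" "0 < t" "t < 1" "1 \<le> q"
  shows "(t * x + (1 - t) * y) powr q \<le> t * x powr q + (1 - t) * y powr q"
proof -
  have scale: "(s * z) powr q \<le> s * z powr q" if "0 < s" "s < 1" "0 \<le> z" for s z :: real
  proof -
    have "s powr q \<le> s powr 1"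
      using that assms by (intro powr_mono') auto
    with that show ?thesis
      by (simp add: powr_mult mult_right_mono)
  qed
  show ?thesis
  \<comment> \<open>\<open>powr_convex\<close> is applied to two positive points only. If one point
    is zero, the claim reduces to \<open>scale\<close>, that is, to s^q \<le> s for s in (0,
    1).\<close>
  proof (cases "x = 0 \<or> y = 0")
    case True
    then show ?thesis
      using scale[of t x] scale[of "1 - t" y] assms by auto
  next
    case False
    then show ?thesis
      using convex_onD[OF powr_convex[OF assms(5)], of "1 - t" x y] assms by simp
  qed
qed

text \<open>The \<open>L\<^sup>q\<close> norm for functions that may take the value \<top>. The norm
  itself may be infinite, so the inequalities below carry no integrability conditions.\<close>

definition eLp :: "'a measure \<Rightarrow> real \<Rightarrow> ('a \<Rightarrow> ennreal) \<Rightarrow> ennreal" where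
  "eLp M q g = epow (\<integral>\<^sup>+ x. epow (g x) q \<partial>M) (1 / q)"

lemma eLp_mono:
  assumes "0 < q" "\<And>x. x \<in> space M \<Longrightarrow> g x \<le> g' x"
  shows "eLp M q g \<le> eLp M q g'"
  unfolding eLp_def using assms by (intro epow_mono nn_integral_mono) auto

lemma eLp_const:
  assumes "prob_space M" "0 < q"
  shows "eLp M q (\<lambda>_. c) = c"
  using assms by (simp add: eLp_def epow_epow prob_space.emeasure_space_1)

lemma eLp_cmult:
  assumes "g \<in> borel_measurable M" "0 < q" "0 < c"
  shows "eLp M q (\<lambda>x. ennreal c * g x) = ennreal c * eLp M q g"
  using assms by (simp add: eLp_def epow_mult_ennreal nn_integral_cmult powr_powr)

lemma eLp_cmult_numeral:
  assumes "g \<in> borel_measurable M" "0 < q"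
  shows "eLp M q (\<lambda>x. numeral n * g x) = numeral n * eLp M q g"
  using eLp_cmult[OF assms, of "numeral n"] by simp

lemma eLp_le_iff:
  assumes "0 < q" "0 \<le> a"
  shows "eLp M q g \<le> ennreal a \<longleftrightarrow> (\<integral>\<^sup>+ x. epow (g x) q \<partial>M) \<le> ennreal (a powr q)"
proof
  assume "eLp M q g \<le> ennreal a"
  from epow_mono[OF _ this, of q] show "(\<integral>\<^sup>+ x. epow (g x) q \<partial>M) \<le> ennreal (a powr q)"
    using assms by (simp add: eLp_def epow_epow epow_ennreal)
next
  assume "(\<integral>\<^sup>+ x. epow (g x) q \<partial>M) \<le> ennreal (a powr q)"
  from epow_mono[OF _ this, of "1 / q"] show "eLp M q g \<le> ennreal a"
    using assms by (simp add: eLp_def epow_ennreal powr_powr)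
qed

text \<open>With t = a / (a + b), the sum x + y is (a + b) times the convex combination of x / a and
  y / b with weights t and 1 - t, so convexity of the q-th power applies. In Minkowski's inequality,
  \<open>a\<close> and \<open>b\<close> are bounds for the norms of the two summands.\<close>

lemma epow_add_le:
  fixes x y :: ennreal and a b q :: real
  assumes "0 < a" "0 < b" "1 \<le> q"
  shows "epow (x + y) q \<le>
    ennreal ((a + b) powr (q - 1) * a powr (1 - q)) * epow x q +
    ennreal ((a + b) powr (q - 1) * b powr (1 - q)) * epow y q"
proof (cases "x = \<top> \<or> y = \<top>")
  \<comment> \<open>Both coefficients are positive, so the right-hand side is infinite as
    well.\<close>
  case True
  with assms show ?thesis
    by (auto simp: ennreal_mult_top)
next
  case False
  then obtain u v where uv: "x = ennreal u" "0 \<le> u" "y = ennreal v" "0 \<le> v"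
    by (cases x; cases y) auto
  define t where "t = a / (a + b)"
  have t: "0 < t" "t < 1" "1 - t = b / (a + b)"
    using assms by (auto simp: t_def field_simps)
  have coeff: "(a + b) powr q * (c / (a + b) * (w / c) powr q) =
      (a + b) powr (q - 1) * c powr (1 - q) * w powr q" if "0 < c" "0 \<le> w" for c w
    using that assms by (simp add: powr_divide powr_diff powr_add field_simps)
  have "u + v = (a + b) * (t * (u / a) + (1 - t) * (v / b))"
    using assms unfolding t(3) by (simp add: t_def flip: add_divide_distrib)
  then have "(u + v) powr q = (a + b) powr q * (t * (u / a) + (1 - t) * (v / b)) powr q"
    using assms uv t(1,2) by (simp add: powr_mult)
  also have "\<dots> \<le> (a + b) powr q * (t * (u / a) powr q + (1 - t) * (v / b) powr q)"
    using assms uv t by (intro mult_left_mono powr_convex_combination) auto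
  also have "\<dots> = (a + b) powr (q - 1) * a powr (1 - q) * u powr q +
      (a + b) powr (q - 1) * b powr (1 - q) * v powr q"
    using coeff[of a u] coeff[of b v] assms uv unfolding t(3)
    by (simp add: t_def distrib_left)
  finally show ?thesis
    using uv by (simp add: epow_ennreal flip: ennreal_plus ennreal_mult)
qed

text \<open>Integrating \<open>epow_add_le\<close>, with \<open>a\<close> and \<open>b\<close> just
  above the two norms, bounds the integral of the q-th power of the sum by (a + b)^q.\<close>

lemma Minkowski_eLp:
  assumes [measurable]: "g \<in> borel_measurable M" "g' \<in> borel_measurable M" and q: "1 \<le> q"
  shows "eLp M q (\<lambda>x. g x + g' x) \<le> eLp M q g + eLp M q g'"
proof (rule ennreal_le_epsilon)
  fix e :: real
  assume fin: "eLp M q g + eLp M q g' < \<top>" and e: "0 < e"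
  obtain r s where rs: "eLp M q g = ennreal r" "0 \<le> r" "eLp M q g' = ennreal s" "0 \<le> s"
    using fin by (cases "eLp M q g"; cases "eLp M q g'") auto
  \<comment> \<open>The slack e / 2 makes both weights positive even if a norm vanishes; the two
    halves add up to the allowed error \<open>e\<close>.\<close>
  define a b where "a = r + e / 2" and "b = s + e / 2"
  have pos: "0 < a" "0 < b"
    using rs e by (auto simp: a_def b_def)
  define C where "C = (a + b) powr (q - 1)"
  have int: "(\<integral>\<^sup>+ x. epow (g x) q \<partial>M) \<le> ennreal (a powr q)"
      "(\<integral>\<^sup>+ x. epow (g' x) q \<partial>M) \<le> ennreal (b powr q)"
    using rs e q pos by (auto simp: a_def b_def ennreal_leI simp flip: eLp_le_iff)
  have "(\<integral>\<^sup>+ x. epow (g x + g' x) q \<partial>M) \<le>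
      (\<integral>\<^sup>+ x. ennreal (C * a powr (1 - q)) * epow (g x) q +
        ennreal (C * b powr (1 - q)) * epow (g' x) q \<partial>M)"
    unfolding C_def using pos q by (intro nn_integral_mono epow_add_le)
  also have "\<dots> = ennreal (C * a powr (1 - q)) * (\<integral>\<^sup>+ x. epow (g x) q \<partial>M) +
      ennreal (C * b powr (1 - q)) * (\<integral>\<^sup>+ x. epow (g' x) q \<partial>M)"
    by (simp add: nn_integral_add nn_integral_cmult)
  also have "\<dots> \<le> ennreal (C * a powr (1 - q)) * ennreal (a powr q) +
      ennreal (C * b powr (1 - q)) * ennreal (b powr q)"
    by (intro add_mono mult_left_mono int) auto
  also have "\<dots> = ennreal (C * (a powr (1 - q) * a powr q) + C * (b powr (1 - q) * b powr q))"
    by (simp add: C_def mult.assoc flip: ennreal_plus ennreal_mult)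
  also have "C * (a powr (1 - q) * a powr q) + C * (b powr (1 - q) * b powr q) = C * (a + b)"
    using pos by (simp add: distrib_left flip: powr_add)
  also have "\<dots> = (a + b) powr q"
    using pos by (simp add: C_def powr_diff)
  finally have "eLp M q (\<lambda>x. g x + g' x) \<le> ennreal (a + b)"
    using pos q by (simp add: eLp_le_iff del: ennreal_plus)
  also have "ennreal (a + b) = eLp M q g + eLp M q g' + ennreal e"
    using rs e by (simp add: a_def b_def flip: ennreal_plus)
  finally show "eLp M q (\<lambda>x. g x + g' x) \<le> eLp M q g + eLp M q g' + ennreal e" .
qed

section \<open>Pointwise bounds for the selection rule\<close>

lemma semimetric_triangle: "semimetric l \<Longrightarrow> l x z \<le> l x y + l y z"
  by (simp add: semimetric_def)

lemma semimetric_sym: "semimetric l \<Longrightarrow> l x y = l y x"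
  by (simp add: semimetric_def)

text \<open>Go from \<open>Ahat2 h \<eta>\<close> to \<open>Ahat \<eta>\<close> through
  \<open>Lam2 h \<eta> f\<close> and \<open>Lam \<eta> f\<close>. Each of the two stochastic errors
  costs one \<open>Psi \<eta>\<close>, and these are compensated by the
  \<open>2 * Psi \<eta>\<close> subtracted in \<open>Rhat\<close>.\<close>

lemma Rhat_le:
  assumes l: "semimetric l"
    and Z1: "\<And>\<eta>. \<eta> \<in> H \<Longrightarrow> l (Ahat \<eta> x) (Lam \<eta> f) \<le> Psi \<eta> x + z1" and "0 \<le> z1"
    and Z2: "\<And>\<eta>. \<eta> \<in> H \<Longrightarrow> l (Ahat2 h \<eta> x) (Lam2 h \<eta> f) \<le> Psi \<eta> x + z2" and "0 \<le> z2"
    and s: "\<And>\<eta>. \<eta> \<in> H \<Longrightarrow> l (Lam2 h \<eta> f) (Lam \<eta> f) \<le> s" and "0 \<le> s"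
  shows "Rhat l H Ahat Ahat2 Psi x h \<le> ennreal (s + z1 + z2)"
  unfolding Rhat_def
proof (intro SUP_least ennreal_leI max.boundedI)
  fix \<eta> assume "\<eta> \<in> H"
  have "l (Ahat2 h \<eta> x) (Ahat \<eta> x) \<le>
      l (Ahat2 h \<eta> x) (Lam2 h \<eta> f) + (l (Lam2 h \<eta> f) (Lam \<eta> f) + l (Ahat \<eta> x) (Lam \<eta> f))"
    using semimetric_triangle[OF l, of "Ahat2 h \<eta> x" "Ahat \<eta> x" "Lam2 h \<eta> f"]
      semimetric_triangle[OF l, of "Lam2 h \<eta> f" "Ahat \<eta> x" "Lam \<eta> f"]
      semimetric_sym[OF l, of "Lam \<eta> f" "Ahat \<eta> x"] by linarith
  with Z1 Z2 s \<open>\<eta> \<in> H\<close> show "l (Ahat2 h \<eta> x) (Ahat \<eta> x) - 2 * Psi \<eta> x \<le> s + z1 + z2"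
    by fastforce
qed (use assms in auto)

lemma le_Rhat:
  assumes "\<eta> \<in> H" "Rhat l H Ahat Ahat2 Psi x h \<le> ennreal r" "0 \<le> r"
  shows "l (Ahat2 h \<eta> x) (Ahat \<eta> x) \<le> r + 2 * Psi \<eta> x"
proof -
  have "ennreal (max 0 (l (Ahat2 h \<eta> x) (Ahat \<eta> x) - 2 * Psi \<eta> x)) \<le> ennreal r"
    using assms(1) by (intro order.trans[OF SUP_upper assms(2)[unfolded Rhat_def]])
  with assms(3) show ?thesis
    by simp
qed

text \<open>Replacing the possibly negative tolerance \<open>e\<close> by a nonnegative bound
  \<open>e'\<close> lets the selection inequality return from \<open>ereal\<close> to
  \<open>ennreal\<close>.\<close>

lemma selectedD:
  assumes sel: "selected l H Ahat Ahat2 Psi e x k" and "e \<le> e'" "0 \<le> e'" "h \<in> H"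
  shows "Rhat l H Ahat Ahat2 Psi x k + ennreal (2 * Psi k x) \<le>
    Rhat l H Ahat Ahat2 Psi x h + ennreal (2 * Psi h x) + ennreal e'"
proof -
  let ?V = "\<lambda>h. Rhat l H Ahat Ahat2 Psi x h + ennreal (2 * Psi h x)"
  have "(INF h\<in>H. ?V h) \<le> ?V h"
    using assms by (intro INF_lower)
  then have "enn2ereal (?V k) \<le> enn2ereal (?V h) + ereal e'"
    using sel assms(2) unfolding selected_def
    by (intro order.trans[OF conjunct2[OF sel[unfolded selected_def]]] add_mono)
      (auto simp: less_eq_ennreal.rep_eq)
  also have "\<dots> = enn2ereal (?V h + ennreal e')"
    using assms(3) by (simp add: plus_ennreal.rep_eq)
  finally show ?thesis
    by (simp add: less_eq_ennreal.rep_eq)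
qed

lemma loss_selected_le:
  assumes l: "semimetric l"
    and perm: "\<And>h \<eta>. Ahat2 h \<eta> x = Ahat2 \<eta> h x"
    and Psi: "\<And>h. 0 < Psi h x"
    and sel: "selected l H Ahat Ahat2 Psi e x k" and e: "e \<le> e'" "0 \<le> e'"
    and h: "h \<in> H"
    and Z1: "\<And>\<eta>. \<eta> \<in> H \<Longrightarrow> ennreal (max 0 (l (Ahat \<eta> x) (Lam \<eta> f) - Psi \<eta> x)) \<le> Z1"
    and Z2: "\<And>\<eta>. \<eta> \<in> H \<Longrightarrow> ennreal (max 0
      (l (Ahat2 h \<eta> x) (Lam2 h \<eta> f) - min (Psi h x) (Psi \<eta> x))) \<le> Z2"
  shows "ennreal (l (Ahat k x) (A f)) \<le>
    bias l H Lam Lam2 A f h + ennreal e' + 5 * ennreal (Psi h x) + 3 * Z1 + 2 * Z2"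
proof -
  let ?sup = "SUP \<eta>\<in>H. ennreal (l (Lam2 h \<eta> f) (Lam \<eta> f))"
  let ?R = "Rhat l H Ahat Ahat2 Psi x"
  show ?thesis
  proof (cases "Z1 = \<top> \<or> Z2 = \<top> \<or> ?sup = \<top>")
    \<comment> \<open>An infinite supremum makes the claimed bound infinite. Otherwise everything is
      real and linear arithmetic suffices.\<close>
    case True
    then consider "Z1 = \<top>" | "Z2 = \<top>" | "?sup = \<top>"
      by blast
    then show ?thesis
      by cases (simp_all only: bias_def ennreal_mult_top add_top top_add
        zero_neq_numeral[symmetric] if_False zero_le top_greatest)
  next
    case False
    then obtain z1 z2 s where z: "Z1 = ennreal z1" "0 \<le> z1" "Z2 = ennreal z2" "0 \<le> z2"
        "?sup = ennreal s" "0 \<le> s"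
      by (cases Z1; cases Z2; cases ?sup) auto
    define r where "r = s + z1 + z2"
    have z1: "l (Ahat \<eta> x) (Lam \<eta> f) \<le> Psi \<eta> x + z1" if "\<eta> \<in> H" for \<eta>
      using Z1[OF that] z by simp
    \<comment> \<open>Of the minimum in the upper function only the bound by
      \<open>Psi \<eta>\<close> is kept: the second index is the one that \<open>Rhat\<close>
      penalizes.\<close>
    have z2: "l (Ahat2 h \<eta> x) (Lam2 h \<eta> f) \<le> Psi \<eta> x + z2" if "\<eta> \<in> H" for \<eta>
      using Z2[OF that] z by simp
    have s: "l (Lam2 h \<eta> f) (Lam \<eta> f) \<le> s" if "\<eta> \<in> H" for \<eta>
      using SUP_upper[OF that, of "\<lambda>\<eta>. ennreal (l (Lam2 h \<eta> f) (Lam \<eta> f))"] z by simp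
    have k: "k \<in> H"
      using sel by (simp add: selected_def)
    have Rh: "?R h \<le> ennreal r"
      unfolding r_def using z1 z2 s z by (intro Rhat_le[OF l]) auto
    have "?R k + ennreal (2 * Psi k x) \<le> ?R h + ennreal (2 * Psi h x) + ennreal e'"
      by (rule selectedD[OF sel e h])
    also have "\<dots> \<le> ennreal r + ennreal (2 * Psi h x) + ennreal e'"
      by (intro add_mono Rh) auto
    also have "\<dots> = ennreal (r + 2 * Psi h x + e')"
      using z e Psi[of h] by (simp add: r_def flip: ennreal_plus)
    finally have sum: "?R k + ennreal (2 * Psi k x) \<le> ennreal (r + 2 * Psi h x + e')" .
    then obtain rk where rk: "?R k = ennreal rk" "0 \<le> rk"
      by (cases "?R k") (auto simp: top_unique)
    have sum': "rk + 2 * Psi k x \<le> r + 2 * Psi h x + e'"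
      using sum z e Psi[of h] Psi[of k] unfolding rk(1)
      by (simp add: rk r_def flip: ennreal_plus)
    have "l (Ahat2 h k x) (Ahat k x) \<le> r + 2 * Psi k x"
      using Rh k z by (intro le_Rhat) (auto simp: r_def)
    moreover have "l (Ahat2 k h x) (Ahat h x) \<le> rk + 2 * Psi h x"
      using rk h by (intro le_Rhat) auto
    \<comment> \<open>The first leg is a term of \<open>Rhat\<close> at \<open>h\<close> and the
      second a term of \<open>Rhat\<close> at \<open>k\<close>; by the permutation hypothesis they
      share an intermediate point.\<close>
    moreover have "l (Ahat k x) (A f) \<le> l (Ahat2 h k x) (Ahat k x) +
        (l (Ahat2 k h x) (Ahat h x) + (l (Ahat h x) (Lam h f) + l (Lam h f) (A f)))"
      using semimetric_triangle[OF l, of "Ahat k x" "A f" "Ahat2 h k x"]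
        semimetric_triangle[OF l, of "Ahat2 k h x" "A f" "Ahat h x"]
        semimetric_triangle[OF l, of "Ahat h x" "A f" "Lam h f"]
        semimetric_sym[OF l, of "Ahat k x" "Ahat2 h k x"] perm[of h k] by simp
    \<comment> \<open>The legs add up to r + 2 Psi k + rk + 2 Psi h + (Psi h + z1) plus the distance
      from \<open>Lam h f\<close> to \<open>A f\<close>. The selection inequality
      \<open>sum'\<close> removes rk + 2 Psi k, leaving 2 r + 5 Psi h + z1 + e', where r = s + z1 +
      z2.\<close>
    ultimately have "l (Ahat k x) (A f) \<le>
        l (Lam h f) (A f) + 2 * s + e' + 5 * Psi h x + 3 * z1 + 2 * z2"
      using z1[OF h] sum' unfolding r_def by linarith
    moreover have "0 \<le> l (Lam h f) (A f)"
      using l by (simp add: semimetric_def)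
    ultimately show ?thesis
      using z e less_imp_le[OF Psi[of h]] unfolding bias_def z
      by (simp add: numeral_mult_ennreal flip: ennreal_plus)
  qed
qed

section \<open>The oracle inequality for the risk\<close>

theorem theorem1:
  fixes T :: "nat \<Rightarrow> 'w measure" and P :: "nat \<Rightarrow> 'f \<Rightarrow> 'w measure"
    and M1 :: "nat \<Rightarrow> 'x1 measure" and M2 :: "nat \<Rightarrow> 'x2 measure"
    and X1 :: "nat \<Rightarrow> 'w \<Rightarrow> 'x1" and X2 :: "nat \<Rightarrow> 'w \<Rightarrow> 'x2"
    and P1 :: "nat \<Rightarrow> 'f \<Rightarrow> 'x1 measure"
    and S :: "'s measure" and l :: "'s \<Rightarrow> 's \<Rightarrow> real" and A :: "'f \<Rightarrow> 's"
    and H :: "nat \<Rightarrow> 'h set"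
    and Ahat :: "nat \<Rightarrow> 'h \<Rightarrow> 'x1 \<Rightarrow> 's" and Ahat2 :: "nat \<Rightarrow> 'h \<Rightarrow> 'h \<Rightarrow> 'x1 \<Rightarrow> 's"
    and Lam :: "nat \<Rightarrow> 'h \<Rightarrow> 'f \<Rightarrow> 's" and Lam2 :: "nat \<Rightarrow> 'h \<Rightarrow> 'h \<Rightarrow> 'f \<Rightarrow> 's"
    and Psi :: "nat \<Rightarrow> 'h \<Rightarrow> 'x1 \<Rightarrow> real"
    and eps eps' :: "nat \<Rightarrow> real" and q :: real
    and hhat :: "nat \<Rightarrow> 'x1 \<Rightarrow> 'h"
  assumes prob: "\<And>n f. n \<ge> 1 \<Longrightarrow> prob_space (P n f) \<and> sets (P n f) = sets (T n)"
    and indep: "\<And>n f. n \<ge> 1 \<Longrightarrow> indep_elements (P n f) (M1 n) (X1 n) (M2 n) (X2 n)"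
    and P1: "\<And>n f. n \<ge> 1 \<Longrightarrow> P1 n f = distr (P n f) (M1 n) (X1 n)"
    and semimetric: "semimetric l"
    and S: "space S = UNIV"
    and H: "\<And>n. n \<ge> 1 \<Longrightarrow> countable (H n)"
    and Ahat: "\<And>n h. n \<ge> 1 \<Longrightarrow> Ahat n h \<in> M1 n \<rightarrow>\<^sub>M S"
    and Ahat2: "\<And>n h \<eta>. n \<ge> 1 \<Longrightarrow> Ahat2 n h \<eta> \<in> M1 n \<rightarrow>\<^sub>M S"
    and Psi: "\<And>n h. n \<ge> 1 \<Longrightarrow> Psi n h \<in> borel_measurable (M1 n)"
    and Psi_pos: "\<And>n h x. n \<ge> 1 \<Longrightarrow> x \<in> space (M1 n) \<Longrightarrow> Psi n h x > 0"
    and q: "q \<ge> 1"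
    and eps_nonneg: "\<And>n. n \<ge> 1 \<Longrightarrow> eps n \<ge> 0"
    and eps_lim: "eps \<longlonglongrightarrow> 0"
    and permutation: "\<And>n h \<eta> x. n \<ge> 1 \<Longrightarrow> x \<in> space (M1 n) \<Longrightarrow> Ahat2 n h \<eta> x = Ahat2 n \<eta> h x"
    and upper1_measurable: "\<And>n f. n \<ge> 1 \<Longrightarrow>
      (\<lambda>x. SUP h\<in>H n. ennreal (max 0 (l (Ahat n h x) (Lam n h f) - Psi n h x) powr q))
        \<in> borel_measurable (M1 n)"
    and upper1: "\<And>n. n \<ge> 1 \<Longrightarrow>
      (SUP f. \<integral>\<^sup>+ x. (SUP h\<in>H n.
          ennreal (max 0 (l (Ahat n h x) (Lam n h f) - Psi n h x) powr q)) \<partial>P1 n f)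
        \<le> ennreal (eps n powr q)"
    and upper2_measurable: "\<And>n f. n \<ge> 1 \<Longrightarrow>
      (\<lambda>x. SUP h\<in>H n. SUP \<eta>\<in>H n. ennreal (max 0
          (l (Ahat2 n h \<eta> x) (Lam2 n h \<eta> f) - min (Psi n h x) (Psi n \<eta> x)) powr q))
        \<in> borel_measurable (M1 n)"
    and upper2: "\<And>n. n \<ge> 1 \<Longrightarrow>
      (SUP f. \<integral>\<^sup>+ x. (SUP h\<in>H n. SUP \<eta>\<in>H n. ennreal (max 0
          (l (Ahat2 n h \<eta> x) (Lam2 n h \<eta> f) - min (Psi n h x) (Psi n \<eta> x)) powr q)) \<partial>P1 n f)
        \<le> ennreal (eps n powr q)"
    and eps': "\<And>n. n \<ge> 1 \<Longrightarrow> eps' n \<le> eps n"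
    and hhat: "\<And>n. n \<ge> 1 \<Longrightarrow> hhat n \<in> M1 n \<rightarrow>\<^sub>M count_space (H n)"
    and selection: "\<And>n x. n \<ge> 1 \<Longrightarrow> x \<in> space (M1 n) \<Longrightarrow>
      selected l (H n) (Ahat n) (Ahat2 n) (Psi n) (eps' n) x (hhat n x)"
    and risk_measurable: "\<And>n f. n \<ge> 1 \<Longrightarrow>
      (\<lambda>\<omega>. l (Ahat n (hhat n (X1 n \<omega>)) (X1 n \<omega>)) (A f)) \<in> borel_measurable (P n f)"
  shows "\<forall>f. \<forall>n\<ge>1.
      risk (P n f) l q (\<lambda>\<omega>. Ahat n (hhat n (X1 n \<omega>)) (X1 n \<omega>)) (A f)
        \<le> (INF h\<in>H n. bias l (H n) (Lam n) (Lam2 n) A f h + 5 * psi (P1 n f) q (Psi n) h)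
           + 6 * ennreal (eps n)"
proof (intro allI impI)
  fix f and n :: nat
  assume n: "1 \<le> n"
  let ?Y = "\<lambda>x. ennreal (l (Ahat n (hhat n x) x) (A f))"
  \<comment> \<open>The root is taken outside the supremum, so the q-th power of \<open>Z1\<close>
    is literally the variable in the hypothesis; likewise for \<open>Z2\<close>. The fact
    \<open>root\<close> then recovers the bound on each single term.\<close>
  define Z1 where "Z1 x = epow (SUP h\<in>H n.
    ennreal (max 0 (l (Ahat n h x) (Lam n h f) - Psi n h x) powr q)) (1 / q)" for x
  define Z2 where "Z2 x = epow (SUP h\<in>H n. SUP \<eta>\<in>H n. ennreal (max 0
    (l (Ahat2 n h \<eta> x) (Lam2 n h \<eta> f) - min (Psi n h x) (Psi n \<eta> x)) powr q)) (1 / q)" for x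
  note [measurable] = Psi[OF n] upper1_measurable[OF n] upper2_measurable[OF n]
  have X1 [measurable]: "X1 n \<in> P n f \<rightarrow>\<^sub>M M1 n"
    using indep[OF n] by (simp add: indep_elements_def)
  have sets_P1 [measurable_cong]: "sets (P1 n f) = sets (M1 n)"
    by (simp add: P1[OF n])
  have space_P1: "space (P1 n f) = space (M1 n)"
    by (simp add: P1[OF n])
  have prob_P1: "prob_space (P1 n f)"
    using prob[OF n] X1 unfolding P1[OF n] by (intro prob_space.prob_space_distr) auto
  have q0: "0 < q"
    using q by simp
  have root: "ennreal c \<le> epow V (1 / q)" if "ennreal (c powr q) \<le> V" "0 \<le> c" for c V
    using epow_mono[OF _ that(1), of "1 / q"] that(2) q0 by (simp add: epow_ennreal powr_powr)
  have [measurable]: "Z1 \<in> borel_measurable (P1 n f)" "Z2 \<in> borel_measurable (P1 n f)"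
    unfolding Z1_def Z2_def by measurable
  have Z1: "eLp (P1 n f) q Z1 \<le> ennreal (eps n)"
    using order.trans[OF SUP_upper[OF UNIV_I] upper1[OF n], of f] eps_nonneg[OF n] q0
    by (simp add: eLp_le_iff Z1_def epow_epow)
  have Z2: "eLp (P1 n f) q Z2 \<le> ennreal (eps n)"
    using order.trans[OF SUP_upper[OF UNIV_I] upper2[OF n], of f] eps_nonneg[OF n] q0
    by (simp add: eLp_le_iff Z2_def epow_epow)
  \<comment> \<open>The estimator depends on the sample through \<open>X1\<close> only, so its risk
    can be bounded under the law of \<open>X1\<close>. The loss is first dominated by a measurable
    \<open>g\<close>, and the change of variables is applied to \<open>g\<close>.\<close>
  have risk: "risk (P n f) l q (\<lambda>\<omega>. Ahat n (hhat n (X1 n \<omega>)) (X1 n \<omega>)) (A f) \<le> eLp (P1 n f) q g"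
    if [measurable]: "g \<in> borel_measurable (P1 n f)" and g: "\<And>x. x \<in> space (M1 n) \<Longrightarrow> ?Y x \<le> g x" for g
  proof -
    have [measurable]: "g \<in> borel_measurable (M1 n)"
      using that(1) by measurable
    have "risk (P n f) l q (\<lambda>\<omega>. Ahat n (hhat n (X1 n \<omega>)) (X1 n \<omega>)) (A f) =
        eLp (P n f) q (\<lambda>\<omega>. ?Y (X1 n \<omega>))"
      using semimetric by (simp add: risk_def eLp_def epow_ennreal semimetric_def)
    also have "\<dots> \<le> eLp (P n f) q (\<lambda>\<omega>. g (X1 n \<omega>))"
      using q0 g measurable_space[OF X1] by (intro eLp_mono) auto
    also have "\<dots> = eLp (P1 n f) q g"
      unfolding eLp_def P1[OF n] by (simp add: nn_integral_distr)
    finally show ?thesis .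
  qed
  have risk_le: "risk (P n f) l q (\<lambda>\<omega>. Ahat n (hhat n (X1 n \<omega>)) (X1 n \<omega>)) (A f) \<le>
      bias l (H n) (Lam n) (Lam2 n) A f h + 5 * psi (P1 n f) q (Psi n) h + 6 * ennreal (eps n)"
    if h: "h \<in> H n" for h
  proof -
    \<comment> \<open>The deterministic part of the bound, with the tolerance \<epsilon>' enlarged
      to \<epsilon>. Under a probability measure it is its own \<open>L\<^sup>q\<close>
      norm.\<close>
    define c where "c = bias l (H n) (Lam n) (Lam2 n) A f h + ennreal (eps n)"
    let ?Psi = "\<lambda>x. ennreal (Psi n h x)"
    have pointwise: "?Y x \<le> c + 5 * ?Psi x + 3 * Z1 x + 2 * Z2 x" if x: "x \<in> space (M1 n)" for x
      unfolding c_def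
    proof (rule loss_selected_le[OF semimetric _ _ selection[OF n x] eps'[OF n] eps_nonneg[OF n] h])
      fix \<eta> assume \<eta>: "\<eta> \<in> H n"
      show "ennreal (max 0 (l (Ahat n \<eta> x) (Lam n \<eta> f) - Psi n \<eta> x)) \<le> Z1 x"
        unfolding Z1_def by (intro root SUP_upper \<eta>) simp
      show "ennreal (max 0
          (l (Ahat2 n h \<eta> x) (Lam2 n h \<eta> f) - min (Psi n h x) (Psi n \<eta> x))) \<le> Z2 x"
        unfolding Z2_def by (intro root SUP_upper2[OF h] SUP_upper \<eta>) simp
    qed (use permutation[OF n x] Psi_pos[OF n x] in auto)
    \<comment> \<open>Positivity of \<open>Psi\<close> ensures that the embedding into
      \<open>ennreal\<close> truncates nothing.\<close>
    have psi: "eLp (P1 n f) q ?Psi = psi (P1 n f) q (Psi n) h"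
      unfolding eLp_def psi_def
      by (intro arg_cong[where f = "\<lambda>v. epow v (1 / q)"] nn_integral_cong)
        (use Psi_pos[OF n] in \<open>auto simp: space_P1 epow_ennreal less_imp_le\<close>)
    have "risk (P n f) l q (\<lambda>\<omega>. Ahat n (hhat n (X1 n \<omega>)) (X1 n \<omega>)) (A f) \<le>
        eLp (P1 n f) q (\<lambda>x. c + 5 * ?Psi x + 3 * Z1 x + 2 * Z2 x)"
      by (rule risk) (use pointwise in auto)
    also have "\<dots> \<le> eLp (P1 n f) q (\<lambda>x. c + 5 * ?Psi x + 3 * Z1 x) + eLp (P1 n f) q (\<lambda>x. 2 * Z2 x)"
      by (rule Minkowski_eLp[OF _ _ q]) measurable
    also have "\<dots> \<le> eLp (P1 n f) q (\<lambda>x. c + 5 * ?Psi x) + eLp (P1 n f) q (\<lambda>x. 3 * Z1 x)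
        + eLp (P1 n f) q (\<lambda>x. 2 * Z2 x)"
      by (intro add_right_mono Minkowski_eLp[OF _ _ q]) measurable
    also have "\<dots> \<le> eLp (P1 n f) q (\<lambda>x. c) + eLp (P1 n f) q (\<lambda>x. 5 * ?Psi x)
        + eLp (P1 n f) q (\<lambda>x. 3 * Z1 x) + eLp (P1 n f) q (\<lambda>x. 2 * Z2 x)"
      by (intro add_right_mono Minkowski_eLp[OF _ _ q]) measurable
    also have "\<dots> = c + 5 * psi (P1 n f) q (Psi n) h
        + 3 * eLp (P1 n f) q Z1 + 2 * eLp (P1 n f) q Z2"
      using q0 prob_P1 by (simp add: eLp_const eLp_cmult_numeral psi)
    also have "\<dots> \<le> c + 5 * psi (P1 n f) q (Psi n) h + 3 * ennreal (eps n) + 2 * ennreal (eps n)"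
      by (intro add_mono mult_left_mono Z1 Z2) auto
    also have "\<dots> = bias l (H n) (Lam n) (Lam2 n) A f h + 5 * psi (P1 n f) q (Psi n) h
        + (ennreal (eps n) + 3 * ennreal (eps n) + 2 * ennreal (eps n))"
      by (simp add: c_def ac_simps)
    \<comment> \<open>One \<epsilon> comes from the tolerance, three from \<open>Z1\<close> and two
      from \<open>Z2\<close>.\<close>
    also have "ennreal (eps n) + 3 * ennreal (eps n) + 2 * ennreal (eps n) = 6 * ennreal (eps n)"
      using eps_nonneg[OF n] by (simp add: numeral_mult_ennreal flip: ennreal_plus)
    finally show ?thesis .
  qed
  show "risk (P n f) l q (\<lambda>\<omega>. Ahat n (hhat n (X1 n \<omega>)) (X1 n \<omega>)) (A f) \<le>
      (INF h\<in>H n. bias l (H n) (Lam n) (Lam2 n) A f h + 5 * psi (P1 n f) q (Psi n) h)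
        + 6 * ennreal (eps n)"
  proof -
    let ?r = "risk (P n f) l q (\<lambda>\<omega>. Ahat n (hhat n (X1 n \<omega>)) (X1 n \<omega>)) (A f)"
    \<comment> \<open>Moving the finite term 6 \<epsilon> to the left isolates the infimum, which
      can then be bounded below index by index.\<close>
    have "?r - 6 * ennreal (eps n) \<le>
        (INF h\<in>H n. bias l (H n) (Lam n) (Lam2 n) A f h + 5 * psi (P1 n f) q (Psi n) h)"
      using risk_le by (intro INF_greatest) (simp add: ennreal_minus_le_iff ennreal_mult_eq_top_iff add.commute)
    then show ?thesis
      by (simp add: ennreal_minus_le_iff add.commute)
  qed
qed

end
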